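(* There is a $2\times 3$ matrix $A$ with integer entries which is doubly image partition regular but such that there does not exist a positive integer $b$ for which the $2\times 5$ matrix $(\,A\ \ -bI_2\,)$ is kernel partition regular, where $I_2$ is the $2\times2$ identity matrix.
   Context: $\mathbb{N}$ denotes the set of positive integers. A finite colouring of $\mathbb{N}$ is a map $\varphi:\mathbb{N}\to\{1,\ldots,r\}$ for some $r\in\mathbb{N}$; a vector is monochromatic if $\varphi$ is constant on its entries. A $u\times v$ rational matrix $M$ is kernel partition regular if whenever $\mathbb{N}$ is finitely coloured there exists a monochromatic $\vec x\in\mathbb{N}^v$ with $M\vec x=\vec 0$. A $u\times v$ rational matrix $A$ is doubly image partition regular if whenever $\mathbb{N}$ is finitely coloured there exists a monochromatic $\vec x\in\mathbb{N}^v$ such that the entries of $A\vec x$ are also monochromatic (possibly with a different colour from that of $\vec x$). *)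

theory Defs
  imports "Jordan_Normal_Form.Matrix"
begin

text \<open>The positive integers are the nonzero elements of \<^typ>\<open>nat\<close>; the value of a colouring
  at 0 is unconstrained and never used.\<close>

definition finite_colouring :: "nat \<Rightarrow> (nat \<Rightarrow> nat) \<Rightarrow> bool" where
  "finite_colouring r \<phi> \<longleftrightarrow> r > 0 \<and> (\<forall>n>0. \<phi> n \<in> {1..r})"

definition pos_vec :: "nat \<Rightarrow> nat vec set" where
  "pos_vec v = {x \<in> carrier_vec v. \<forall>n \<in> set\<^sub>v x. n > 0}"

definition monochromatic :: "(nat \<Rightarrow> nat) \<Rightarrow> nat vec \<Rightarrow> bool" where
  "monochromatic \<phi> x \<longleftrightarrow> (\<exists>c. \<forall>n \<in> set\<^sub>v x. \<phi> n = c)"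

definition kernel_partition_regular :: "rat mat \<Rightarrow> bool" where
  "kernel_partition_regular M \<longleftrightarrow>
     (\<forall>r \<phi>. finite_colouring r \<phi> \<longrightarrow>
        (\<exists>x \<in> pos_vec (dim_col M). monochromatic \<phi> x \<and>
           M *\<^sub>v map_vec of_nat x = 0\<^sub>v (dim_row M)))"

text \<open>For the entries of \<open>A x\<close> to be monochromatic they must be coloured at all, that is, they
  must be positive integers; hence the witness \<open>y\<close>.\<close>

definition doubly_image_partition_regular :: "rat mat \<Rightarrow> bool" where
  "doubly_image_partition_regular A \<longleftrightarrow>
     (\<forall>r \<phi>. finite_colouring r \<phi> \<longrightarrow>
        (\<exists>x \<in> pos_vec (dim_col A). monochromatic \<phi> x \<and>
           (\<exists>y \<in> pos_vec (dim_row A). A *\<^sub>v map_vec of_nat x = map_vec of_nat y \<and>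
              monochromatic \<phi> y)))"

text \<open>The block matrix \<open>(A B)\<close>, the column counterpart of \<^const>\<open>append_rows\<close>; meaningful only when
  \<open>A\<close> and \<open>B\<close> have the same number of rows.\<close>

definition append_cols :: "'a :: zero mat \<Rightarrow> 'a mat \<Rightarrow> 'a mat" where
  "append_cols A B = four_block_mat A B (0\<^sub>m 0 (dim_col A)) (0\<^sub>m 0 (dim_col B))"

end

theory Submission
  imports Defs "HOL-Computational_Algebra.Primes" "HOL-Library.FuncSet"
begin

text \<open>
  Take \<open>A\<close> with rows \<open>(1, -1, 0)\<close> and \<open>(3, -3, -1)\<close>. On \<open>x = (a + e, a, 2 e)\<close> both entries of
  \<open>A x\<close> equal \<open>e\<close>, so \<open>A\<close> is doubly image partition regular because the equation
  \<open>2 (x\<^sub>1 - x\<^sub>2) = x\<^sub>3\<close> is partition regular. On the other hand \<open>A x = b y\<close> forces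
  \<open>x\<^sub>3 + b y\<^sub>2 = 3 b y\<^sub>1\<close>. For integers \<open>b > 0\<close> no nonempty subset of the coefficients
  \<open>1\<close>, \<open>b\<close>, \<open>- 3 b\<close> sums to zero, so by Rado's argument colouring by the last nonzero digit in a
  prime base \<open>p > 3 b\<close> admits no monochromatic solution. (The solutions above correspond to
  \<open>b = 1/2\<close>.)
\<close>

section \<open>Partition regularity of \<open>2 (x\<^sub>1 - x\<^sub>2) = x\<^sub>3\<close>\<close>

text \<open>The translates of \<open>D\<^sup>M\<close> by the vectors \<open>t (1, \<dots>, M)\<close>, \<open>t < m\<close>, lie in \<open>{1..2 m M}\<^sup>M\<close>, where
  they are too large to be pairwise disjoint.\<close>

lemma multiples_in_difference_set:
  fixes D :: "nat set"
  assumes D: "D \<subseteq> {1..m * M}" and dense: "m * M \<le> r * card D" and m: "(2 * r) ^ M < m"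
  shows "\<exists>e>0. e < m \<and> (\<forall>k\<in>{1..M}. \<exists>x\<in>D. x + k * e \<in> D)"
proof -
  define F :: "(nat \<Rightarrow> nat) \<times> nat \<Rightarrow> nat \<Rightarrow> nat"
    where "F = (\<lambda>(f, t). \<lambda>k\<in>{1..M}. f k + k * t)"
  define P where "P = (PiE {1..M} (\<lambda>_. D)) \<times> {..<m}"
  define Q where "Q = PiE {1..M} (\<lambda>_. {1..2 * (m * M)})"
  have cP: "card P = card D ^ M * m"
    by (simp add: P_def card_cartesian_product card_PiE)
  have cQ: "card Q = (2 * (m * M)) ^ M"
    by (simp add: Q_def card_PiE)
  have "finite Q"
    by (simp add: Q_def finite_PiE)
  have "F p \<in> Q" if "p \<in> P" for p
  proof -
    obtain f t where p: "p = (f, t)" and f: "f \<in> PiE {1..M} (\<lambda>_. D)" and t: "t < m"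
      using \<open>p \<in> P\<close> by (auto simp: P_def)
    have "f k + k * t \<in> {1..2 * (m * M)}" if k: "k \<in> {1..M}" for k
    proof -
      have "f k \<in> {1..m * M}"
        using f k D by blast
      moreover have "k * t \<le> M * m"
        using k t by (intro mult_mono) auto
      ultimately show ?thesis
        by (simp add: mult.commute)
    qed
    then show ?thesis
      by (simp add: F_def Q_def p)
  qed
  then have FPQ: "F ` P \<subseteq> Q"
    by blast
  \<comment> \<open>Injectivity would give \<open>card D ^ M * m \<le> (2 * (m * M)) ^ M\<close>. By
    density the right side is at most \<open>(2 * r) ^ M * card D ^ M\<close>, against the choice of
    \<open>m\<close>.\<close>
  have "\<not> inj_on F P"
  proof
    assume "inj_on F P"
    then have "card P \<le> card Q"
      using FPQ \<open>finite Q\<close> by (rule card_inj_on_le)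
    also have "\<dots> \<le> (2 * (r * card D)) ^ M"
      unfolding cQ using dense by (intro power_mono) auto
    also have "\<dots> = (2 * r) ^ M * card D ^ M"
      by (simp add: power_mult_distrib)
    also have "\<dots> < m * card D ^ M"
    proof -
      have "card D ^ M > 0"
        using dense m by (cases "M = 0"; cases "card D = 0") auto
      then show ?thesis
        using m by simp
    qed
    finally show False
      by (simp add: cP)
  qed
  then obtain f g t u where fg: "(f, t) \<in> P" "(g, u) \<in> P" "F (f, t) = F (g, u)" "(f, t) \<noteq> (g, u)"
    by (auto simp: inj_on_def)
  have eq: "f k + k * t = g k + k * u" if "k \<in> {1..M}" for k
    using fun_cong[OF fg(3), of k] that by (simp add: F_def)
  have mem: "f k \<in> D" "g k \<in> D" if "k \<in> {1..M}" for k
    using fg(1,2) that by (auto simp: P_def)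
  have lt: "t < m" "u < m"
    using fg(1,2) by (auto simp: P_def)
  \<comment> \<open>Equal shifts would force \<open>f = g\<close>. With different shifts, one number
    \<open>e\<close>, the gap between \<open>t\<close> and \<open>u\<close>, serves all
    \<open>k\<close> at once.\<close>
  have "t \<noteq> u"
  proof
    assume "t = u"
    moreover have "f = g"
      using fg(1,2) eq \<open>t = u\<close> by (intro PiE_ext[of f "{1..M}" "\<lambda>_. D"]) (auto simp: P_def)
    ultimately show False
      using fg(4) by simp
  qed
  then consider "t < u" | "u < t"
    by linarith
  then show ?thesis
  proof cases
    case 1
    have "\<exists>x\<in>D. x + k * (u - t) \<in> D" if k: "k \<in> {1..M}" for k
    proof -
      have "f k = g k + k * (u - t)"
        using eq[OF k] 1 by (simp add: diff_mult_distrib2)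
      then show ?thesis
        using mem[OF k] by metis
    qed
    then show ?thesis
      using 1 lt by (intro exI[of _ "u - t"]) auto
  next
    case 2
    have "\<exists>x\<in>D. x + k * (t - u) \<in> D" if k: "k \<in> {1..M}" for k
    proof -
      have "g k = f k + k * (t - u)"
        using eq[OF k] 2 by (simp add: diff_mult_distrib2)
      then show ?thesis
        using mem[OF k] by metis
    qed
    then show ?thesis
      using 2 lt by (intro exI[of _ "t - u"]) auto
  qed
qed

text \<open>Pigeonhole: classes that are all below average size cannot add up to
  \<open>card A\<close>. The product form avoids division.\<close>

lemma large_colour_class:
  fixes \<phi> :: "'a \<Rightarrow> 'b"
  assumes "finite A" "finite C" "C \<noteq> {}" and \<phi>: "\<And>a. a \<in> A \<Longrightarrow> \<phi> a \<in> C"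
  shows "\<exists>c\<in>C. card A \<le> card C * card {a \<in> A. \<phi> a = c}"
proof (rule ccontr)
  assume "\<not> ?thesis"
  then have less: "card C * card {a \<in> A. \<phi> a = c} < card A" if "c \<in> C" for c
    using that by auto
  have "card A = (\<Sum>c\<in>C. card {a \<in> A. \<phi> a = c})"
    using assms by (subst card_UN_disjoint[symmetric]) (auto intro!: arg_cong[of _ _ card])
  then have "card C * card A = (\<Sum>c\<in>C. card C * card {a \<in> A. \<phi> a = c})"
    by (simp add: sum_distrib_left)
  also have "\<dots> < (\<Sum>c\<in>C. card A)"
    using assms less by (intro sum_strict_mono) auto
  finally show False
    by simp
qed

text \<open>For a dense colour class \<open>D\<close>, a whole progression of numbers \<open>2 k e\<close> with \<open>k e \<in> D - D\<close>
  either meets \<open>D\<close>, which gives a solution, or uses one colour fewer.\<close>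

lemma two_times_difference_finite:
  "\<exists>N. \<forall>C (\<phi> :: nat \<Rightarrow> 'c) d. finite C \<longrightarrow> card C = r \<longrightarrow> d > 0 \<longrightarrow> (\<forall>n\<in>{1..N}. \<phi> (d * n) \<in> C) \<longrightarrow>
     (\<exists>x>0. \<exists>e>0. \<phi> (x + e) = \<phi> x \<and> \<phi> (2 * e) = \<phi> x)"
proof (induction r)
  case 0
  show ?case
    \<comment> \<open>Here \<open>C\<close> is empty, and \<open>N = 1\<close> makes the range of
      \<open>n\<close> nonempty, so the hypothesis on \<open>\<phi>\<close> is
      contradictory.\<close>
    by (intro exI[of _ 1]) auto
next
  case (Suc r)
  then obtain M where M: "\<And>C (\<phi> :: nat \<Rightarrow> 'c) d.
      finite C \<Longrightarrow> card C = r \<Longrightarrow> d > 0 \<Longrightarrow> (\<And>n. n \<in> {1..M} \<Longrightarrow> \<phi> (d * n) \<in> C) \<Longrightarrow>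
      \<exists>x>0. \<exists>e>0. \<phi> (x + e) = \<phi> x \<and> \<phi> (2 * e) = \<phi> x"
    by metis
  define m where "m = Suc ((2 * Suc r) ^ M)"
  show ?case
  proof (rule exI[of _ "2 * (m * M)"], intro allI impI)
    fix C and \<phi> :: "nat \<Rightarrow> 'c" and d :: nat
    assume C: "finite C" "card C = Suc r" and d: "d > 0"
      and \<phi>: "\<forall>n\<in>{1..2 * (m * M)}. \<phi> (d * n) \<in> C"
    have "C \<noteq> {}"
      using C by auto
    then obtain c where c: "c \<in> C"
      and large: "card {1..m * M} \<le> card C * card {n \<in> {1..m * M}. \<phi> (d * n) = c}"
      using large_colour_class[of "{1..m * M}" C "\<lambda>n. \<phi> (d * n)"] C \<phi> by auto
    define D where "D = {n \<in> {1..m * M}. \<phi> (d * n) = c}"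
    have "\<exists>e>0. e < m \<and> (\<forall>k\<in>{1..M}. \<exists>x\<in>D. x + k * e \<in> D)"
    proof (rule multiples_in_difference_set)
      show "m * M \<le> Suc r * card D"
        using large C by (simp add: D_def)
    qed (auto simp: D_def m_def)
    then obtain e where e: "e > 0" "e < m" and diff: "\<forall>k\<in>{1..M}. \<exists>x\<in>D. x + k * e \<in> D"
      by blast
    show "\<exists>x>0. \<exists>e>0. \<phi> (x + e) = \<phi> x \<and> \<phi> (2 * e) = \<phi> x"
    proof (cases "\<exists>k\<in>{1..M}. \<phi> (2 * (d * (k * e))) = c")
      case True
      then obtain k where k: "k \<in> {1..M}" "\<phi> (2 * (d * (k * e))) = c"
        by blast
      then obtain x where "x \<in> D" "x + k * e \<in> D"
        using diff by blast
      then have x: "x > 0" "\<phi> (d * x) = c" "\<phi> (d * (x + k * e)) = c"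
        by (auto simp: D_def)
      show ?thesis
        using x k e d
        by (intro exI[of _ "d * x"] exI[of _ "d * (k * e)"] conjI) (simp_all add: distrib_left)
    next
      case False
      show ?thesis
      \<comment> \<open>The factor \<open>d\<close> was kept general for this step: the numbers
        \<open>2 * d * e * n\<close> form a dilated copy of \<open>{1..M}\<close> that misses colour
        \<open>c\<close>.\<close>
      proof (rule M[where C = "C - {c}" and \<phi> = \<phi> and d = "2 * d * e"])
        fix n assume n: "n \<in> {1..M}"
        have "e * n \<le> m * M"
          using e n by (intro mult_mono) auto
        then have "2 * (e * n) \<in> {1..2 * (m * M)}"
          using e n by auto
        then have "\<phi> (d * (2 * (e * n))) \<in> C"
          using \<phi> by blast
        moreover have "\<phi> (2 * (d * (n * e))) \<noteq> c"
          using False n by blast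
        ultimately show "\<phi> (2 * d * e * n) \<in> C - {c}"
          by (simp add: ac_simps)
      qed (use C c d e in auto)
    qed
  qed
qed

lemma two_times_difference:
  assumes "finite_colouring r \<phi>"
  shows "\<exists>x>0. \<exists>e>0. \<phi> (x + e) = \<phi> x \<and> \<phi> (2 * e) = \<phi> x"
proof -
  obtain N where N: "\<forall>C (\<phi> :: nat \<Rightarrow> nat) d. finite C \<longrightarrow> card C = r \<longrightarrow> d > 0 \<longrightarrow>
      (\<forall>n\<in>{1..N}. \<phi> (d * n) \<in> C) \<longrightarrow>
      (\<exists>x>0. \<exists>e>0. \<phi> (x + e) = \<phi> x \<and> \<phi> (2 * e) = \<phi> x)"
    using two_times_difference_finite[of r] by (rule exE)
  have "\<forall>n\<in>{1..N}. \<phi> (1 * n) \<in> {1..r}"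
    using assms by (auto simp: finite_colouring_def)
  then show ?thesis
    using N[THEN spec[of _ "{1..r}"], THEN spec[of _ \<phi>], THEN spec[of _ 1]] by simp
qed

section \<open>Colouring by the last nonzero digit\<close>

definition last_digit :: "nat \<Rightarrow> nat \<Rightarrow> nat" where
  "last_digit p n = n div p ^ multiplicity p n mod p"

lemma last_digit_pos:
  assumes "prime p" "n > 0"
  shows "0 < last_digit p n"
proof -
  have "\<not> p dvd n div p ^ multiplicity p n"
    using assms by (intro multiplicity_decompose) auto
  then show ?thesis
    by (simp add: last_digit_def dvd_eq_mod_eq_0)
qed

lemma finite_colouring_last_digit:
  assumes "prime p"
  shows "finite_colouring p (last_digit p)"
proof -
  have "last_digit p n \<in> {1..p}" if "n > 0" for n
    using last_digit_pos[OF assms that] prime_gt_0_nat[OF assms]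
      mod_less_divisor[of p "n div p ^ multiplicity p n"]
    unfolding last_digit_def by auto
  then show ?thesis
    using prime_gt_0_nat[OF assms] by (simp add: finite_colouring_def)
qed

text \<open>The base \<open>p\<close> digit of \<open>n\<close> at position \<open>v\<close> is the
  last nonzero digit if the multiplicity is exactly \<open>v\<close>, and 0 if it is larger. The
  indicator treats both cases uniformly.\<close>

lemma last_digit_cong:
  assumes "v \<le> multiplicity p n"
  shows "int p ^ Suc v dvd
    int n - int p ^ v * (int (last_digit p n) * of_bool (multiplicity p n = v))"
proof (cases "multiplicity p n = v")
  case True
  define q where "q = n div p ^ v"
  have "n = p ^ v * q"
    using multiplicity_dvd[of p n] True by (simp add: q_def)
  moreover have "q = p * (q div p) + last_digit p n"
    by (simp add: last_digit_def q_def True)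
  ultimately have "int n = int p ^ v * (int p * int (q div p) + int (last_digit p n))"
    by (metis of_nat_add of_nat_mult of_nat_power)
  then have "int n - int p ^ v * int (last_digit p n) = int p ^ Suc v * int (q div p)"
    by (simp add: algebra_simps)
  then show ?thesis
    using True by simp
next
  case False
  then have "p ^ Suc v dvd n"
    using assms by (intro multiplicity_dvd') auto
  then have "int (p ^ Suc v) dvd int n"
    by (simp only: of_nat_dvd_iff)
  then show ?thesis
    using False by simp
qed

text \<open>Reduce the equation modulo \<open>p ^ Suc v\<close>, where \<open>v\<close> is the least
  of the three multiplicities. Cancelling \<open>p ^ v\<close> and the common digit \<open>l\<close>
  leaves \<open>p\<close> dividing the sum \<open>s\<close> of those coefficients whose variable has
  multiplicity \<open>v\<close>.\<close>

lemma no_monochromatic_solution: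
  fixes b p x y z :: nat
  assumes p: "prime p" "3 * b < p" and b: "b > 0" and pos: "x > 0"
    and xy: "last_digit p x = last_digit p y" and xz: "last_digit p x = last_digit p z"
  shows "x + b * y \<noteq> 3 * b * z"
proof
  assume eq: "x + b * y = 3 * b * z"
  define l where "l = last_digit p x"
  define v where "v = min (multiplicity p x) (min (multiplicity p y) (multiplicity p z))"
  define \<epsilon> where "\<epsilon> n = (of_bool (multiplicity p n = v) :: int)" for n
  define s where "s = \<epsilon> x + int b * \<epsilon> y - 3 * int b * \<epsilon> z"
  have digit: "int p ^ Suc v dvd int n - int p ^ v * (int l * \<epsilon> n)" if "n \<in> {x, y, z}" for n
  proof -
    have "last_digit p n = l" "v \<le> multiplicity p n"
      using that xy xz by (auto simp: l_def v_def)
    then show ?thesis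
      using last_digit_cong[of v p n] by (simp add: \<epsilon>_def)
  qed
  have "int p ^ Suc v dvd (int x - int p ^ v * (int l * \<epsilon> x)) + int b * (int y - int p ^ v * (int l * \<epsilon> y))
      - 3 * int b * (int z - int p ^ v * (int l * \<epsilon> z))"
    using digit by (meson dvd_add dvd_diff dvd_mult insertI1 insertI2)
  also have "\<dots> = (int x + int b * int y - 3 * int b * int z) - int p ^ v * (int l * s)"
    by (simp add: s_def algebra_simps)
  also have "int x + int b * int y - 3 * int b * int z = 0"
    using arg_cong[OF eq, of int] by simp
  finally have "int p ^ v * int p dvd int p ^ v * (int l * s)"
    by (simp add: mult.commute)
  then have "int p dvd int l * s"
    using prime_gt_0_nat[OF p(1)] by simp
  moreover have "\<not> int p dvd int l"
    using last_digit_pos[OF p(1) pos] prime_gt_0_nat[OF p(1)]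
    by (auto simp: l_def last_digit_def dvd_eq_mod_eq_0 simp flip: zmod_int)
  ultimately have "int p dvd s"
    using p(1) by (simp add: prime_dvd_mult_iff)
  \<comment> \<open>The minimum \<open>v\<close> is attained, so \<open>s\<close> is one of
    \<open>1\<close>, \<open>b\<close>, \<open>1 + b\<close>, \<open>-3b\<close>,
    \<open>1 - 3b\<close>, \<open>-2b\<close>, \<open>1 - 2b\<close>. None vanishes for an integer
    \<open>b > 0\<close>, and all are at most \<open>3b\<close> in absolute value.\<close>
  moreover have "\<bar>s\<bar> < int p" "s \<noteq> 0"
    using b p(2) by (auto simp: s_def \<epsilon>_def v_def min_def split: if_splits)
  ultimately show False
    using zdvd_not_zless[of "\<bar>s\<bar>" "int p"] by simp
qed

section \<open>The matrix\<close>

lemma set_vec_of_list: "set\<^sub>v (vec_of_list xs) = set xs"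
  by (metis list_vec set_list_of_vec)

lemma sum_upto_3: "sum f {0..<3::nat} = f 0 + f 1 + (f 2 :: 'a :: comm_monoid_add)"
  by (simp add: eval_nat_numeral)

lemma sum_upto_5:
  "sum f {0..<5::nat} = f 0 + f 1 + f 2 + f 3 + (f 4 :: 'a :: comm_monoid_add)"
  by (simp add: eval_nat_numeral)

definition witness_mat :: "rat mat" where
  "witness_mat = mat_of_rows_list 3 [[1, -1, 0], [3, -3, -1]]"

lemma witness_mat_carrier: "witness_mat \<in> carrier_mat 2 3"
  by (rule carrier_matI) (simp_all add: witness_mat_def mat_of_rows_list_def)

lemma elements_witness_mat: "elements_mat witness_mat \<subseteq> \<int>"
proof
  fix a assume "a \<in> elements_mat witness_mat"
  then obtain i j where ij: "i < 2" "j < 3" "a = witness_mat $$ (i, j)"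
    using elements_matD[of a witness_mat] witness_mat_carrier by auto
  then have "i = 0 \<or> i = 1" "j = 0 \<or> j = 1 \<or> j = 2"
    by linarith+
  with ij show "a \<in> \<int>"
    by (auto simp: witness_mat_def mat_of_rows_list_def)
qed

lemma witness_mat_mult_vec:
  assumes "dim_vec x = 3"
  shows "witness_mat *\<^sub>v x = vec_of_list [x $ 0 - x $ 1, 3 * x $ 0 - 3 * x $ 1 - x $ 2]"
proof (rule eq_vecI)
  fix i assume "i < dim_vec (vec_of_list [x $ 0 - x $ 1, 3 * x $ 0 - 3 * x $ 1 - x $ 2])"
  then have "i = 0 \<or> i = 1"
    by (simp add: less_Suc_eq)
  then show "(witness_mat *\<^sub>v x) $ i =
      vec_of_list [x $ 0 - x $ 1, 3 * x $ 0 - 3 * x $ 1 - x $ 2] $ i"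
    using assms
    by (elim disjE)
      (simp_all add: witness_mat_def mat_of_rows_list_def scalar_prod_def sum_upto_3)
qed (simp add: witness_mat_def mat_of_rows_list_def)

lemma doubly_image_partition_regular_witness_mat: "doubly_image_partition_regular witness_mat"
  unfolding doubly_image_partition_regular_def
proof (intro allI impI)
  fix r \<phi> assume "finite_colouring r \<phi>"
  then obtain x e where xe: "x > 0" "e > 0" "\<phi> (x + e) = \<phi> x" "\<phi> (2 * e) = \<phi> x"
    using two_times_difference by blast
  define X where "X = vec_of_list [x + e, x, 2 * e]"
  \<comment> \<open>Both image entries equal \<open>e\<close>, so the image is monochromatic
    whatever colour \<open>e\<close> has.\<close>
  define Y where "Y = vec_of_list [e, e]"
  have image: "witness_mat *\<^sub>v map_vec of_nat X = map_vec of_nat Y"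
  proof -
    have "X $ 0 = x + e" "X $ 1 = x" "X $ 2 = 2 * e" "dim_vec X = 3"
      by (simp_all add: X_def vec_of_list_index del: vec_of_list_Cons)
    then show ?thesis
      by (subst witness_mat_mult_vec) (auto simp: Y_def less_Suc_eq intro!: eq_vecI)
  qed
  have XY: "set\<^sub>v X = {x + e, x, 2 * e}" "set\<^sub>v Y = {e}" "dim_vec X = 3" "dim_vec Y = 2"
    by (simp_all add: X_def Y_def set_vec_of_list del: vec_of_list_Cons)
  have "X \<in> carrier_vec 3" "Y \<in> carrier_vec 2"
    by (rule carrier_vecI, rule XY)+
  then have "X \<in> pos_vec 3" "Y \<in> pos_vec 2"
    unfolding pos_vec_def mem_Collect_eq XY(1,2) using xe(1,2) by simp_all
  moreover have "monochromatic \<phi> X" "monochromatic \<phi> Y"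
    unfolding monochromatic_def XY using xe(3,4) by blast+
  ultimately show "\<exists>x\<in>pos_vec (dim_col witness_mat). monochromatic \<phi> x \<and>
      (\<exists>y\<in>pos_vec (dim_row witness_mat). witness_mat *\<^sub>v map_vec of_nat x = map_vec of_nat y \<and>
        monochromatic \<phi> y)"
    unfolding carrier_matD[OF witness_mat_carrier] using image by blast
qed

text \<open>The colouring may depend on \<open>b\<close>, so one prime beyond \<open>3 * b\<close>
  suffices. The first three entries of a kernel vector are an argument of
  \<open>witness_mat\<close>, the last two its image divided by \<open>b\<close>.\<close>

lemma not_kernel_partition_regular_append_witness_mat:
  assumes b: "b > 0"
  shows "\<not> kernel_partition_regular (append_cols witness_mat (- of_nat b \<cdot>\<^sub>m 1\<^sub>m 2))"
    (is "\<not> kernel_partition_regular ?M")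
proof
  assume kpr: "kernel_partition_regular ?M"
  obtain p where p: "prime p" "3 * b < p"
    using bigger_prime by blast
  have dim: "dim_col ?M = 5" "dim_row ?M = 2"
    using witness_mat_carrier by (auto simp: append_cols_def)
  obtain x where x: "x \<in> pos_vec 5" "monochromatic (last_digit p) x"
    and zero: "?M *\<^sub>v map_vec of_nat x = 0\<^sub>v 2"
    using kpr finite_colouring_last_digit[OF p(1)] dim unfolding kernel_partition_regular_def by metis
  have dx: "dim_vec x = 5"
    using x by (auto simp: pos_vec_def)
  have row0: "of_nat (x $ 0) - of_nat (x $ 1) - of_nat b * of_nat (x $ 3) = (0 :: rat)"
    using arg_cong[OF zero, of "\<lambda>w. w $ 0"] dx
    by (simp add: append_cols_def witness_mat_def mat_of_rows_list_def scalar_prod_def sum_upto_5)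
  have row1: "3 * of_nat (x $ 0) - 3 * of_nat (x $ 1) - of_nat (x $ 2) - of_nat b * of_nat (x $ 4)
      = (0 :: rat)"
    using arg_cong[OF zero, of "\<lambda>w. w $ 1"] dx
    by (simp add: append_cols_def witness_mat_def mat_of_rows_list_def scalar_prod_def sum_upto_5)
  \<comment> \<open>Three times \<open>row0\<close> minus \<open>row1\<close> eliminates
    \<open>x $ 0\<close> and \<open>x $ 1\<close>.\<close>
  have "of_nat (x $ 2 + b * x $ 4) = (of_nat (3 * b * x $ 3) :: rat)"
    using row0 row1 by (simp add: algebra_simps)
  then have "x $ 2 + b * x $ 4 = 3 * b * x $ 3"
    by (simp only: of_nat_eq_iff)
  moreover have "x $ i \<in> set\<^sub>v x" if "i < 5" for i
    using that dx by (simp add: vec_setI)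
  then have "last_digit p (x $ 2) = last_digit p (x $ 4)"
    "last_digit p (x $ 2) = last_digit p (x $ 3)" "x $ 2 > 0"
    using x by (auto simp: monochromatic_def pos_vec_def)
  ultimately show False
    using no_monochromatic_solution[OF p b] by blast
qed

theorem theorem3p4:
  shows "\<exists>A :: rat mat. A \<in> carrier_mat 2 3 \<and> elements_mat A \<subseteq> \<int> \<and>
    doubly_image_partition_regular A \<and>
    \<not> (\<exists>b :: nat. b > 0 \<and>
         kernel_partition_regular (append_cols A (- of_nat b \<cdot>\<^sub>m 1\<^sub>m 2)))"
proof (intro exI conjI)
  show "\<not> (\<exists>b :: nat. b > 0 \<and>
      kernel_partition_regular (append_cols witness_mat (- of_nat b \<cdot>\<^sub>m 1\<^sub>m 2)))"
    using not_kernel_partition_regular_append_witness_mat by blast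
qed (rule witness_mat_carrier elements_witness_mat doubly_image_partition_regular_witness_mat)+

end
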